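(* Let $\mathcal{B}$ be a basis of a Banach space $X$. The following are equivalent: (a) $\mathcal{B}$ is almost greedy; (b) $\mathcal{B}$ is $\lambda$-almost greedy for every $\lambda\geqslant 1$; (c) $\mathcal{B}$ is $\lambda$-almost greedy for some $\lambda\geqslant 1$.
   Context: Let $(X,\|\cdot\|)$ be an infinite-dimensional Banach space over $\mathbb{K}=\mathbb{R}$ or $\mathbb{C}$ with dual $(X^*,\|\cdot\|_* )$. A basis of $X$ is a sequence $\mathcal{B}=(e_n)_{n=1}^\infty$ in $X$ such that: (1) there is a unique sequence $(e_n^* )_{n=1}^\infty$ in $X^*$ with $e_i^*(e_j)=\delta_{i,j}$ for all $i,j$; (2) $\sup_n\|e_n\|\|e_n^*\|_*<\infty$ and $0<\inf_n\|e_n\|\leqslant\sup_n\|e_n\|<\infty$; (3) $X$ is the norm-closed linear span of $\{e_n\}$; (4) $X^*$ is the weak$^*$-closed linear span of $\{e_n^*\}$. Notation: $\mathbb{N}_0=\mathbb{N}\cup\{0\}$. For finite $A\subset\mathbb{N}$, $P_A(x)=\sum_{n\in A}e_n^*(x)e_n$. A finite set $\Lambda\subset\mathbb{N}$ is a greedy set of $x\in X$ if $\min_{n\in\Lambda}|e_n^*(x)|\geqslant\max_{n\notin\Lambda}|e_n^*(x)|$ (the empty set is a greedy set of every $x$). For $m\in\mathbb{N}_0$, $\gamma_m(x)=\sup\{\|x-P_\Lambda(x)\|:\Lambda\text{ is a greedy set of }x,\ |\Lambda|=m\}$ and $\widetilde{\sigma}_m(x)=\inf\{\|x-P_A(x)\|:A\subset\mathbb{N},|A|=m\}$.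 $\mathcal{B}$ is almost greedy if there is $C\geqslant 1$ with $\gamma_m(x)\leqslant C\widetilde{\sigma}_m(x)$ for all $x\in X$, $m\in\mathbb{N}_0$. For $\lambda\geqslant 1$, $\mathcal{B}$ is $\lambda$-almost greedy if there is $C_\lambda\geqslant 1$ with $\gamma_{\lceil\lambda m\rceil}(x)\leqslant C_\lambda\widetilde{\sigma}_m(x)$ for all $x\in X$, $m\in\mathbb{N}_0$. *)

theory Defs
  imports "HOL-Analysis.Analysis" "HOL-Library.Function_Algebras"
begin

text \<open>
  The library provides real Banach spaces only. A Banach space over a scalar field \<open>'k\<close>
  (here the reals or the complex numbers) is a real Banach space with a scalar multiplication
  \<open>scal\<close> by \<open>'k\<close> that extends the real one and for which the norm is homogeneous.
\<close>

locale banach_over = vector_space scal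
  for scal :: "'k::real_normed_field \<Rightarrow> 'a::banach \<Rightarrow> 'a" +
  assumes norm_scal: "norm (scal c x) = norm c * norm x"
    and scal_of_real: "scal (of_real r) x = r *\<^sub>R x"

lemma banach_over_scaleR: "banach_over ((*\<^sub>R) :: real \<Rightarrow> 'a::banach \<Rightarrow> 'a)"
  by unfold_locales (simp_all add: algebra_simps)

definition infinite_dimensional :: "('k::real_normed_field \<Rightarrow> 'a::banach \<Rightarrow> 'a) \<Rightarrow> bool" where
  "infinite_dimensional scal \<longleftrightarrow> \<not> (\<exists>B. finite B \<and> module.span scal B = UNIV)"

text \<open>
  The dual consists of the bounded \<open>'k\<close>-linear functionals; its norm is \<^const>\<open>onorm\<close>.
  The weak* topology is the topology of pointwise convergence.
\<close>

definition dual_space ::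
    "('k::real_normed_field \<Rightarrow> 'a::banach \<Rightarrow> 'a) \<Rightarrow> ('a \<Rightarrow> 'k) set" where
  "dual_space scal = {f. Vector_Spaces.linear scal (*) f \<and> bounded_linear f}"

definition weak_star_topology ::
    "('k::real_normed_field \<Rightarrow> 'a::banach \<Rightarrow> 'a) \<Rightarrow> ('a \<Rightarrow> 'k) topology" where
  "weak_star_topology scal =
     subtopology (product_topology (\<lambda>_. euclidean) UNIV) (dual_space scal)"

definition scal_fun :: "'k::real_normed_field \<Rightarrow> ('a \<Rightarrow> 'k) \<Rightarrow> ('a \<Rightarrow> 'k)" where
  "scal_fun c f = (\<lambda>x. c * f x)"

text \<open>
  Sequences are indexed by \<^typ>\<open>nat\<close> starting from 0 instead of 1; this is only a relabelling.
\<close>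

definition biorthogonal_seq ::
    "('k::real_normed_field \<Rightarrow> 'a::banach \<Rightarrow> 'a) \<Rightarrow> (nat \<Rightarrow> 'a) \<Rightarrow> (nat \<Rightarrow> 'a \<Rightarrow> 'k) \<Rightarrow> bool" where
  "biorthogonal_seq scal e f \<longleftrightarrow>
     (\<forall>n. f n \<in> dual_space scal) \<and> (\<forall>i j. f i (e j) = (if i = j then 1 else 0))"

definition coord ::
    "('k::real_normed_field \<Rightarrow> 'a::banach \<Rightarrow> 'a) \<Rightarrow> (nat \<Rightarrow> 'a) \<Rightarrow> nat \<Rightarrow> 'a \<Rightarrow> 'k" where
  "coord scal e = (THE f. biorthogonal_seq scal e f)"

definition is_basis ::
    "('k::real_normed_field \<Rightarrow> 'a::banach \<Rightarrow> 'a) \<Rightarrow> (nat \<Rightarrow> 'a) \<Rightarrow> bool" where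
  "is_basis scal e \<longleftrightarrow>
     (\<exists>!f. biorthogonal_seq scal e f) \<and>
     bdd_above (range (\<lambda>n. norm (e n) * onorm (coord scal e n))) \<and>
     0 < (INF n. norm (e n)) \<and>
     bdd_above (range (\<lambda>n. norm (e n))) \<and>
     closure (module.span scal (range e)) = UNIV \<and>
     weak_star_topology scal closure_of (module.span scal_fun (range (coord scal e)))
       = dual_space scal"

definition proj ::
    "('k::real_normed_field \<Rightarrow> 'a::banach \<Rightarrow> 'a) \<Rightarrow> (nat \<Rightarrow> 'a) \<Rightarrow> nat set \<Rightarrow> 'a \<Rightarrow> 'a" where
  "proj scal e A x = (\<Sum>n\<in>A. scal (coord scal e n x) (e n))"

text \<open>
  The inequality between the minimum over \<open>L\<close> and the maximum over its complement is spelled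
  out elementwise, which also covers the convention for the empty set.
\<close>

definition greedy_set ::
    "('k::real_normed_field \<Rightarrow> 'a::banach \<Rightarrow> 'a) \<Rightarrow> (nat \<Rightarrow> 'a) \<Rightarrow> 'a \<Rightarrow> nat set \<Rightarrow> bool" where
  "greedy_set scal e x L \<longleftrightarrow>
     finite L \<and> (\<forall>i\<in>L. \<forall>j. j \<notin> L \<longrightarrow> norm (coord scal e j x) \<le> norm (coord scal e i x))"

text \<open>
  The real supremum below is meaningful for a basis: greedy sets of every size exist because the
  coefficients tend to 0, and the norms are bounded because \<open>norm (e n) * onorm (coord scal e n)\<close>
  is bounded.
\<close>

definition greedy_error ::
    "('k::real_normed_field \<Rightarrow> 'a::banach \<Rightarrow> 'a) \<Rightarrow> (nat \<Rightarrow> 'a) \<Rightarrow> nat \<Rightarrow> 'a \<Rightarrow> real" where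
  "greedy_error scal e m x =
     (SUP L\<in>{L. greedy_set scal e x L \<and> card L = m}. norm (x - proj scal e L x))"

definition proj_error ::
    "('k::real_normed_field \<Rightarrow> 'a::banach \<Rightarrow> 'a) \<Rightarrow> (nat \<Rightarrow> 'a) \<Rightarrow> nat \<Rightarrow> 'a \<Rightarrow> real" where
  "proj_error scal e m x =
     (INF A\<in>{A. finite A \<and> card A = m}. norm (x - proj scal e A x))"

definition almost_greedy ::
    "('k::real_normed_field \<Rightarrow> 'a::banach \<Rightarrow> 'a) \<Rightarrow> (nat \<Rightarrow> 'a) \<Rightarrow> bool" where
  "almost_greedy scal e \<longleftrightarrow>
     (\<exists>C\<ge>1. \<forall>x m. greedy_error scal e m x \<le> C * proj_error scal e m x)"

definition lambda_almost_greedy ::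
    "real \<Rightarrow> ('k::real_normed_field \<Rightarrow> 'a::banach \<Rightarrow> 'a) \<Rightarrow> (nat \<Rightarrow> 'a) \<Rightarrow> bool" where
  "lambda_almost_greedy l scal e \<longleftrightarrow>
     (\<exists>C\<ge>1. \<forall>x m. greedy_error scal e (nat \<lceil>l * real m\<rceil>) x \<le> C * proj_error scal e m x)"

end

theory Submission
  imports Defs
begin

text \<open>
  Two features of the coordinates of a basis make the comparison of \<open>\<lambda>\<close>-almost greediness and
  almost greediness elementary: they tend to 0 along the basis (so a set of indices can be enlarged
  by far-away indices at no cost, and the projection error \<open>\<sigma>\<^sub>m\<close> decreases in \<open>m\<close>), and projecting
  onto a bounded number of coordinates is uniformly bounded (so changing the size of a set by a
  bounded amount costs only a constant).

  The passage from almost greedy to \<open>\<lambda>\<close>-almost greedy rests on the monotonicity of \<open>\<sigma>\<close>: the greedy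
  error of order \<open>\<lceil>\<lambda>m\<rceil> \<ge> m\<close> is controlled by the projection error of the same order, hence
  by the one of order \<open>m\<close>.

  Conversely, let the basis be \<open>\<lambda>\<close>-almost greedy. The two features give a constant \<open>C\<close> with
  \<open>\<parallel>x - P\<^sub>L x\<parallel> \<le> C \<parallel>x - P\<^sub>A x\<parallel>\<close> for every greedy set \<open>L\<close> of \<open>x\<close> and every finite set \<open>A\<close> with
  \<open>\<lambda>|A| \<le> |L|\<close> (lemma \<open>lambda_greedy_bound\<close>); for \<open>A = {}\<close> this says that the basis is
  quasi-greedy. Now let \<open>|A| = |L|\<close> and put \<open>y = x - P\<^sub>A x\<close>, \<open>B = L - A\<close>, \<open>D = A - L\<close>. Then
  \<open>x - P\<^sub>L x = (y - P\<^sub>B y) + P\<^sub>D x\<close>, where \<open>B\<close> is a greedy set of \<open>y\<close>, so that the first summand is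
  at most \<open>C \<parallel>y\<parallel>\<close>. For the second one, if \<open>|D| = |B| < \<lambda>\<close> then boundedly many coordinates are
  involved; otherwise \<open>D\<close> is cut into boundedly many pieces \<open>E\<close> of size at most \<open>|B| / \<lambda>\<close>. The set \<open>B\<close> is still greedy for \<open>y + P\<^sub>E x\<close>, and removing \<open>E\<close> from this vector gives
  back \<open>y\<close>; so \<open>\<parallel>(y - P\<^sub>B y) + P\<^sub>E x\<parallel> \<le> C \<parallel>y\<parallel>\<close> and hence \<open>\<parallel>P\<^sub>E x\<parallel> \<le> 2C \<parallel>y\<parallel>\<close> (lemma
  \<open>norm_proj_small_piece_le\<close>).
\<close>

section \<open>Coordinates of a basis\<close>

locale banach_basis = banach_over scal
  for scal :: "'k::real_normed_field \<Rightarrow> 'a::banach \<Rightarrow> 'a" +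
  fixes e :: "nat \<Rightarrow> 'a"
  assumes basis: "is_basis scal e"
begin

abbreviation "f \<equiv> coord scal e"
abbreviation "P \<equiv> proj scal e"
abbreviation "greedy \<equiv> greedy_set scal e"

lemma biorthogonal_coord: "biorthogonal_seq scal e f"
  unfolding coord_def by (rule theI'[where P = "biorthogonal_seq scal e"])
    (use basis in \<open>simp add: is_basis_def\<close>)

lemma linear_coord: "Vector_Spaces.linear scal (*) (f n)"
  using biorthogonal_coord by (auto simp: biorthogonal_seq_def dual_space_def)

lemma bounded_linear_coord: "bounded_linear (f n)"
  using biorthogonal_coord by (auto simp: biorthogonal_seq_def dual_space_def)

lemma coord_basis: "f i (e j) = (if i = j then 1 else 0)"
  using biorthogonal_coord by (auto simp: biorthogonal_seq_def)

lemma coord_add: "f n (x + y) = f n x + f n y"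
  using linear_coord[of n] by (simp add: Vector_Spaces.linear_iff)

lemma coord_diff: "f n (x - y) = f n x - f n y"
  by (rule linear_diff[OF bounded_linear.linear[OF bounded_linear_coord]])

lemma coord_scal: "f n (scal c x) = c * f n x"
  using linear_coord[of n] by (simp add: Vector_Spaces.linear_iff)

lemma coord_sum: "f n (sum g A) = (\<Sum>a\<in>A. f n (g a))"
  by (rule linear_sum[OF bounded_linear.linear[OF bounded_linear_coord]])

lemma coord_proj: "finite A \<Longrightarrow> f j (P A x) = (if j \<in> A then f j x else 0)"
proof -
  assume A: "finite A"
  have "f j (P A x) = (\<Sum>n\<in>A. if j = n then f j x else 0)"
    unfolding proj_def coord_sum by (rule sum.cong) (auto simp: coord_scal coord_basis)
  then show ?thesis using A by simp
qed

lemma proj_add: "P A (x + y) = P A x + P A y"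
  by (simp add: proj_def coord_add scale_left_distrib sum.distrib)

lemma proj_diff: "P A (x - y) = P A x - P A y"
  by (simp add: proj_def coord_diff scale_left_diff_distrib sum_subtractf)

lemma proj_empty [simp]: "P {} x = 0"
  by (simp add: proj_def)

lemma proj_Un: "\<lbrakk>finite A; finite B; A \<inter> B = {}\<rbrakk> \<Longrightarrow> P (A \<union> B) x = P A x + P B x"
  by (simp add: proj_def sum.union_disjoint)

lemma proj_proj: "\<lbrakk>finite A; finite B\<rbrakk> \<Longrightarrow> P A (P B x) = P (A \<inter> B) x"
proof -
  assume A: "finite A" and B: "finite B"
  have "P A (P B x) = (\<Sum>n\<in>A. if n \<in> B then scal (f n x) (e n) else 0)"
    unfolding proj_def[of _ _ A] by (rule sum.cong) (auto simp: coord_proj[OF B])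
  also have "\<dots> = P (A \<inter> B) x"
    unfolding proj_def using A by (simp add: sum.inter_restrict)
  finally show ?thesis .
qed

lemma norm_proj_le: "norm (P A x) \<le> (\<Sum>n\<in>A. norm (f n x) * norm (e n))"
  unfolding proj_def by (rule sum_norm_le) (simp add: norm_scal)

lemma norm_basis_pos: "0 < norm (e n)"
proof -
  have "(INF n. norm (e n)) \<le> norm (e n)"
    by (rule cINF_lower) (auto intro: bdd_belowI[of _ 0])
  then show ?thesis using basis unfolding is_basis_def by linarith
qed

text \<open>
  Allowing two different indices \<open>i\<close> and \<open>j\<close> is stronger than boundedness of the products
  \<open>\<parallel>e\<^sub>n\<parallel> \<parallel>f\<^sub>n\<parallel>\<close>: it holds because the norms of the basis vectors are bounded above and away from 0.
\<close>

lemma coord_bound: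
  obtains K where "K \<ge> 0" "\<And>i j z. norm (f j z) * norm (e i) \<le> K * norm z"
proof -
  define c where "c = (INF n. norm (e n))"
  have c: "c > 0" using basis by (simp add: is_basis_def c_def)
  have ce: "c \<le> norm (e n)" for n
    unfolding c_def by (rule cINF_lower) (auto intro: bdd_belowI[of _ 0])
  obtain E where E: "\<And>n. norm (e n) \<le> E"
    using basis unfolding is_basis_def bdd_above_def by auto
  obtain S where S: "\<And>n. norm (e n) * onorm (f n) \<le> S"
    using basis unfolding is_basis_def bdd_above_def by auto
  have o0: "0 \<le> onorm (f n)" for n by (rule onorm_pos_le[OF bounded_linear_coord])
  have E0: "0 \<le> E" using E[of 0] norm_ge_zero[of "e 0"] by linarith
  have S0: "0 \<le> S" by (rule order_trans[OF mult_nonneg_nonneg[OF norm_ge_zero o0] S])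
  have o: "onorm (f n) \<le> S / c" for n
  proof -
    have "c * onorm (f n) \<le> norm (e n) * onorm (f n)" using ce o0 by (rule mult_right_mono)
    also note S[of n]
    finally show ?thesis using c by (simp add: field_simps)
  qed
  show thesis
  proof
    show "0 \<le> S / c * E" using S0 c E0 by simp
    fix i j z
    have "norm (f j z) \<le> onorm (f j) * norm z" by (rule onorm[OF bounded_linear_coord])
    also have "\<dots> \<le> S / c * norm z" by (rule mult_right_mono[OF o]) simp
    finally have "norm (f j z) * norm (e i) \<le> (S / c * norm z) * E"
      using E S0 c by (intro mult_mono) auto
    then show "norm (f j z) * norm (e i) \<le> S / c * E * norm z" by (simp add: mult_ac)
  qed
qed

text \<open>
  Vectors in the span of the basis have only finitely many nonzero coordinates, these vectors are
  dense, and the coordinate functionals are uniformly bounded.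
\<close>

lemma coord_tendsto_0: "(\<lambda>n. f n x) \<longlonglongrightarrow> 0"
proof (rule LIMSEQ_I)
  fix r :: real assume r: "r > 0"
  obtain K where K: "K \<ge> 0" "\<And>i j z. norm (f j z) * norm (e i) \<le> K * norm z"
    using coord_bound by blast
  define M where "M = K / norm (e 0) + 1"
  have M: "M > 0" using K(1) by (simp add: M_def add_nonneg_pos)
  have bound: "norm (f n z) \<le> M * norm z" for n z
  proof -
    have "norm (f n z) \<le> K / norm (e 0) * norm z"
      using K(2)[of n z 0] norm_basis_pos[of 0] by (simp add: field_simps)
    also have "\<dots> \<le> M * norm z" unfolding M_def by (rule mult_right_mono) auto
    finally show ?thesis .
  qed
  have "x \<in> closure (span (range e))" using basis by (simp add: is_basis_def)
  moreover have "r / M > 0" using r M by simp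
  ultimately obtain z where z: "z \<in> span (range e)" and d: "dist z x < r / M"
    unfolding closure_approachable by blast
  have "finite {n. f n z \<noteq> 0}"
    using z
  proof (induction rule: span_induct_alt)
    case base
    show ?case by (simp add: linear_0[OF bounded_linear.linear[OF bounded_linear_coord]])
  next
    case (step c v w)
    then obtain k where k: "v = e k" by blast
    have "{n. f n (scal c v + w) \<noteq> 0} \<subseteq> insert k {n. f n w \<noteq> 0}"
      by (auto simp: k coord_add coord_scal coord_basis split: if_splits)
    then show ?case using step by (meson finite.insertI finite_subset)
  qed
  then obtain N where N: "\<And>n. f n z \<noteq> 0 \<Longrightarrow> n < N"
    unfolding finite_nat_set_iff_bounded by blast
  have "norm (f n x - 0) < r" if "n \<ge> N" for n
  proof -
    have "f n z = 0" using N that by (meson not_le)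
    then have "norm (f n x - 0) = norm (f n (z - x))" by (simp add: coord_diff)
    also have "\<dots> \<le> M * norm (z - x)" by (rule bound)
    also have "\<dots> < r" using d M by (simp add: dist_norm field_simps)
    finally show ?thesis .
  qed
  then show "\<exists>N. \<forall>n\<ge>N. norm (f n x - 0) < r" by blast
qed

section \<open>Greedy sets and the two error functionals\<close>

lemma greedy_finite: "greedy x L \<Longrightarrow> finite L"
  by (simp add: greedy_set_def)

lemma greedyD: "\<lbrakk>greedy x L; i \<in> L; j \<notin> L\<rbrakk> \<Longrightarrow> norm (f j x) \<le> norm (f i x)"
  by (simp add: greedy_set_def)

text \<open>
  Since the coordinates tend to 0, the largest one outside a given finite set is attained. Existence
  makes the supremum in the greedy error range over a nonempty set.
\<close>

lemma greedy_set_exists: "\<exists>L. greedy x L \<and> card L = m"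
proof (induction m)
  case 0
  show ?case by (rule exI[of _ "{}"]) (simp add: greedy_set_def)
next
  case (Suc m)
  then obtain L where L: "greedy x L" "card L = m" by blast
  have fin: "finite L" using L greedy_finite by blast
  obtain i where i: "i \<notin> L" "\<And>j. j \<notin> L \<Longrightarrow> norm (f j x) \<le> norm (f i x)"
  proof (cases "\<forall>j. j \<notin> L \<longrightarrow> f j x = 0")
    case True
    obtain i where "i \<notin> L" using fin ex_new_if_finite infinite_UNIV_nat by blast
    then show thesis using that True by simp
  next
    case False
    then obtain k where k: "k \<notin> L" "f k x \<noteq> 0" by blast
    define S where "S = {j. j \<notin> L \<and> norm (f k x) \<le> norm (f j x)}"
    obtain N where N: "\<And>n. n \<ge> N \<Longrightarrow> norm (f n x) < norm (f k x)"
      using LIMSEQ_D[OF coord_tendsto_0, of "norm (f k x)" x] k by auto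
    have "S \<subseteq> {..<N}" using N by (force simp: S_def not_less[symmetric])
    then have "finite S" by (rule finite_subset) simp
    moreover have "k \<in> S" using k by (simp add: S_def)
    ultimately obtain i where i: "i \<in> S" "\<And>j. j \<in> S \<Longrightarrow> norm (f j x) \<le> norm (f i x)"
      using Max_in[of "(\<lambda>j. norm (f j x)) ` S"] Max_ge[of "(\<lambda>j. norm (f j x)) ` S"] by fastforce
    show thesis
    proof (rule that)
      show "i \<notin> L" using i by (simp add: S_def)
      fix j assume j: "j \<notin> L"
      show "norm (f j x) \<le> norm (f i x)"
      proof (cases "j \<in> S")
        case True
        then show ?thesis by (rule i(2))
      next
        case False
        then have "norm (f j x) \<le> norm (f k x)" using j by (simp add: S_def)
        also have "\<dots> \<le> norm (f i x)" using i(1) by (simp add: S_def)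
        finally show ?thesis .
      qed
    qed
  qed
  have "greedy x (insert i L)"
    unfolding greedy_set_def using i fin greedyD[OF L(1)] by auto
  moreover have "card (insert i L) = Suc m" using i L fin by simp
  ultimately show ?case by blast
qed

lemma greedy_subset_exists:
  assumes "greedy x L" "k \<le> card L"
  obtains L' where "L' \<subseteq> L" "greedy x L'" "card L' = k"
proof -
  have "\<exists>L'\<subseteq>L. greedy x L' \<and> card L' = card L - d" if "d \<le> card L" for d
    using that
  proof (induction d)
    case 0
    then show ?case using assms by auto
  next
    case (Suc d)
    then obtain L' where L': "L' \<subseteq> L" "greedy x L'" "card L' = card L - d" by auto
    have fin: "finite L'" using L' greedy_finite by blast
    have "L' \<noteq> {}" using L' Suc.prems by auto
    then obtain i where i: "i \<in> L'" "\<And>j. j \<in> L' \<Longrightarrow> norm (f i x) \<le> norm (f j x)"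
      using Min_in[of "(\<lambda>j. norm (f j x)) ` L'"] Min_le[of "(\<lambda>j. norm (f j x)) ` L'"] fin
      by fastforce
    have "greedy x (L' - {i})"
      unfolding greedy_set_def using i fin greedyD[OF L'(2)] by auto
    moreover have "card (L' - {i}) = card L - Suc d" using i fin L' by simp
    ultimately show ?case using L' by blast
  qed
  from this[of "card L - k"] show thesis using that assms by auto
qed

lemma greedy_error_le:
  assumes "\<And>L. greedy x L \<Longrightarrow> card L = m \<Longrightarrow> norm (x - P L x) \<le> c"
  shows "greedy_error scal e m x \<le> c"
  unfolding greedy_error_def by (rule cSUP_least) (use assms greedy_set_exists in auto)

lemma norm_le_greedy_error:
  assumes "greedy x L" "card L = m"
  shows "norm (x - P L x) \<le> greedy_error scal e m x"
proof -
  obtain K where K: "K \<ge> 0" "\<And>i j z. norm (f j z) * norm (e i) \<le> K * norm z"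
    using coord_bound by blast
  have "norm (x - P A x) \<le> norm x + m * (K * norm x)" if "card A = m" for A
  proof -
    have "norm (P A x) \<le> (\<Sum>n\<in>A. K * norm x)"
      by (rule order_trans[OF norm_proj_le sum_mono]) (rule K(2))
    also have "\<dots> = m * (K * norm x)" using that by simp
    finally show ?thesis using norm_triangle_ineq4[of x "P A x"] by linarith
  qed
  then have "bdd_above ((\<lambda>L. norm (x - P L x)) ` {L. greedy x L \<and> card L = m})"
    by (intro bdd_aboveI[of _ "norm x + m * (K * norm x)"]) auto
  then show ?thesis
    unfolding greedy_error_def by (rule cSUP_upper[rotated]) (use assms in simp)
qed

lemma le_proj_error:
  assumes "\<And>A. finite A \<Longrightarrow> card A = m \<Longrightarrow> c \<le> norm (x - P A x)"
  shows "c \<le> proj_error scal e m x"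
proof -
  have "{..<m} \<in> {A. finite A \<and> card A = m}" by simp
  then have "{A :: nat set. finite A \<and> card A = m} \<noteq> {}" by blast
  then show ?thesis
    unfolding proj_error_def by (rule cINF_greatest) (use assms in auto)
qed

text \<open>
  A set \<open>A\<close> of at most \<open>m\<close> indices bounds the error of order \<open>m\<close>: complete it by indices so
  far away that their coefficients of \<open>x\<close> are negligible.
\<close>

lemma proj_error_le:
  assumes "finite A" "card A \<le> m"
  shows "proj_error scal e m x \<le> norm (x - P A x)"
proof (rule field_le_epsilon)
  fix r :: real assume r: "r > 0"
  obtain E where E: "\<And>n. norm (e n) \<le> E"
    using basis unfolding is_basis_def bdd_above_def by auto
  have E0: "E > 0" using E[of 0] norm_basis_pos[of 0] by linarith
  define \<delta> where "\<delta> = r / ((m + 1) * E)"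
  have "\<delta> > 0" using r E0 by (simp add: \<delta>_def)
  then obtain N where N: "\<And>n. n \<ge> N \<Longrightarrow> norm (f n x) < \<delta>"
    using LIMSEQ_D[OF coord_tendsto_0, of \<delta> x] by auto
  obtain N' where N': "\<And>n. n \<in> A \<Longrightarrow> n < N'"
    using assms(1) unfolding finite_nat_set_iff_bounded by blast
  define F where "F = {max N N'..<max N N' + (m - card A)}"
  have disj: "A \<inter> F = {}" using N' by (fastforce simp: F_def)
  have "card (A \<union> F) = m"
    using assms disj by (simp add: card_Un_disjoint F_def)
  then have AF: "A \<union> F \<in> {A. finite A \<and> card A = m}" using assms by (simp add: F_def)
  have "norm (P F x) \<le> (\<Sum>n\<in>F. \<delta> * E)"
  proof (rule order_trans[OF norm_proj_le sum_mono])
    fix n assume "n \<in> F"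
    then have "norm (f n x) \<le> \<delta>" using N[of n] by (simp add: F_def)
    then show "norm (f n x) * norm (e n) \<le> \<delta> * E"
      by (rule mult_mono) (use E \<open>\<delta> > 0\<close> in auto)
  qed
  also have "\<dots> = (m - card A) * (\<delta> * E)" by (simp add: F_def)
  also have "\<dots> \<le> real (m + 1) * (\<delta> * E)"
    by (rule mult_right_mono) (use \<open>\<delta> > 0\<close> E0 in auto)
  also have "\<dots> = r" using E0 unfolding \<delta>_def by simp
  finally have "norm (P F x) \<le> r" .
  moreover have "P (A \<union> F) x = P A x + P F x"
    by (rule proj_Un) (use assms disj in \<open>auto simp: F_def\<close>)
  ultimately have "norm (x - P (A \<union> F) x) \<le> norm (x - P A x) + r"
    using norm_triangle_ineq4[of "x - P A x" "P F x"] by (simp add: algebra_simps)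
  moreover have "proj_error scal e m x \<le> norm (x - P (A \<union> F) x)"
    unfolding proj_error_def by (rule cINF_lower[OF _ AF]) (auto intro: bdd_belowI[of _ 0])
  ultimately show "proj_error scal e m x \<le> norm (x - P A x) + r" by simp
qed

lemma proj_error_antimono: "m \<le> n \<Longrightarrow> proj_error scal e n x \<le> proj_error scal e m x"
  by (rule le_proj_error) (simp add: proj_error_le)

section \<open>Almost greedy bases are \<open>\<lambda>\<close>-almost greedy\<close>

lemma almost_greedy_imp_lambda:
  assumes "almost_greedy scal e" "l \<ge> 1"
  shows "lambda_almost_greedy l scal e"
proof -
  obtain C where C: "C \<ge> 1" "\<And>x m. greedy_error scal e m x \<le> C * proj_error scal e m x"
    using assms(1) unfolding almost_greedy_def by blast
  have "greedy_error scal e (nat \<lceil>l * real m\<rceil>) x \<le> C * proj_error scal e m x" for x m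
  proof -
    have "real m \<le> l * real m" using assms(2) by (simp add: mult_le_cancel_right1)
    then have "m \<le> nat \<lceil>l * real m\<rceil>" by linarith
    then have "C * proj_error scal e (nat \<lceil>l * real m\<rceil>) x \<le> C * proj_error scal e m x"
      using C(1) by (intro mult_left_mono proj_error_antimono) auto
    with C(2) show ?thesis by (rule order_trans)
  qed
  with C(1) show ?thesis unfolding lambda_almost_greedy_def by blast
qed

section \<open>\<open>\<lambda>\<close>-almost greedy bases are almost greedy\<close>

text \<open>
  The definition only speaks of greedy sets of size \<open>\<lceil>\<lambda>m\<rceil>\<close>. A greedy set \<open>L\<close> of any size contains one
  of this form that has at most \<open>\<lambda>\<close> elements fewer, and the projection onto the missing
  indices is bounded by a constant. The set \<open>A\<close>, of at most \<open>m\<close> elements, bounds the projection error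
  of order \<open>m\<close>.
\<close>

lemma lambda_greedy_bound:
  fixes l :: real
  assumes "lambda_almost_greedy l scal e" and l: "l \<ge> 1"
  obtains C where "C \<ge> 0"
    "\<And>x L A. \<lbrakk>greedy x L; finite A; l * real (card A) \<le> card L\<rbrakk>
       \<Longrightarrow> norm (x - P L x) \<le> C * norm (x - P A x)"
proof -
  obtain C where C: "C \<ge> 1"
    "\<And>x m. greedy_error scal e (nat \<lceil>l * real m\<rceil>) x \<le> C * proj_error scal e m x"
    using assms(1) unfolding lambda_almost_greedy_def by blast
  obtain K where K: "K \<ge> 0" "\<And>i j z. norm (f j z) * norm (e i) \<le> K * norm z"
    using coord_bound by blast
  have "norm (x - P L x) \<le> (1 + l * K) * C * norm (x - P A x)"
    if L: "greedy x L" and A: "finite A" and cards: "l * real (card A) \<le> card L" for x L A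
  proof -
    define m where "m = nat \<lfloor>card L / l\<rfloor>"
    define k where "k = nat \<lceil>l * real m\<rceil>"
    have "real m \<le> card L / l" unfolding m_def using l by (intro of_nat_floor) simp
    then have "l * real m \<le> card L" using l by (simp add: field_simps)
    then have k: "k \<le> card L" unfolding k_def by linarith
    have "card L / l < real m + 1" unfolding m_def by linarith
    then have "card L < l * real m + l" using l by (simp add: field_simps)
    moreover have "l * real m \<le> k" unfolding k_def by linarith
    ultimately have diff: "card L - real k \<le> l" by linarith
    have "real (card A) \<le> card L / l" using cards l by (simp add: field_simps)
    then have Am: "card A \<le> m" unfolding m_def by linarith
    obtain L' where L': "L' \<subseteq> L" "greedy x L'" "card L' = k"
      using greedy_subset_exists[OF L k] by blast
    have fin: "finite L" "finite L'" using L L' greedy_finite by auto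
    let ?z = "x - P L' x"
    have "norm ?z \<le> greedy_error scal e k x" using L' by (intro norm_le_greedy_error)
    also have "\<dots> \<le> C * proj_error scal e m x" unfolding k_def by (rule C(2))
    also have "\<dots> \<le> C * norm (x - P A x)"
      using C(1) A Am by (intro mult_left_mono proj_error_le) auto
    finally have z: "norm ?z \<le> C * norm (x - P A x)" .
    have "norm (P (L - L') ?z) \<le> (\<Sum>n\<in>L - L'. K * norm ?z)"
      by (rule order_trans[OF norm_proj_le sum_mono]) (rule K(2))
    also have "\<dots> = (card L - real k) * (K * norm ?z)"
      using L' fin k by (simp add: card_Diff_subset of_nat_diff)
    also have "\<dots> \<le> l * (K * norm ?z)" using diff K(1) by (intro mult_right_mono) auto
    finally have missing: "norm (P (L - L') ?z) \<le> l * (K * norm ?z)" .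
    have "P (L - L') (P L' x) = 0"
      using fin by (simp add: proj_proj Int_commute)
    moreover have "P L x = P L' x + P (L - L') x"
      using proj_Un[of L' "L - L'" x] fin L'(1) by (simp add: Un_absorb1)
    ultimately have "x - P L x = ?z - P (L - L') ?z"
      by (simp add: proj_diff)
    then have "norm (x - P L x) \<le> norm ?z + norm (P (L - L') ?z)"
      by (metis norm_triangle_ineq4)
    also have "\<dots> \<le> (1 + l * K) * norm ?z" using missing by (simp add: algebra_simps)
    also have "\<dots> \<le> (1 + l * K) * (C * norm (x - P A x))"
      using z l K(1) by (intro mult_left_mono) auto
    finally show ?thesis by simp
  qed
  moreover have "0 \<le> (1 + l * K) * C" using l K C by simp
  ultimately show thesis using that by blast
qed

text \<open>
  The coefficients of \<open>x\<close> on \<open>E\<close> are dominated by those of \<open>y\<close> on its greedy set \<open>B\<close>, so \<open>B\<close> stays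
  greedy when \<open>P\<^sub>E x\<close> is added to \<open>y\<close>, while projecting \<open>E\<close> away undoes the addition.
\<close>

lemma norm_proj_small_piece_le:
  fixes l :: real
  assumes bound: "\<And>x L A. \<lbrakk>greedy x L; finite A; l * real (card A) \<le> card L\<rbrakk>
       \<Longrightarrow> norm (x - P L x) \<le> C * norm (x - P A x)"
    and B: "greedy y B" and E: "finite E" "E \<inter> B = {}" "l * real (card E) \<le> card B"
    and supp: "\<And>n. n \<in> E \<Longrightarrow> f n y = 0"
    and dom: "\<And>n b. n \<in> E \<Longrightarrow> b \<in> B \<Longrightarrow> norm (f n x) \<le> norm (f b y)"
  shows "norm (P E x) \<le> 2 * C * norm y"
proof -
  have finB: "finite B" using B greedy_finite by blast
  let ?w = "y + P E x"
  have w: "f n ?w = (if n \<in> E then f n x else f n y)" for n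
    using E supp by (simp add: coord_add coord_proj)
  have "greedy ?w B"
    unfolding greedy_set_def w using finB E dom greedyD[OF B] by auto
  then have "norm (?w - P B ?w) \<le> C * norm (?w - P E ?w)"
    using E by (intro bound)
  moreover have "P E y = 0" by (simp add: proj_def supp)
  then have "?w - P E ?w = y" using E by (simp add: proj_add proj_proj)
  moreover have "B \<inter> E = {}" using E by blast
  then have "?w - P B ?w = (y - P B y) + P E x" using E finB by (simp add: proj_add proj_proj)
  ultimately have "norm ((y - P B y) + P E x) \<le> C * norm y" by simp
  moreover have "norm (y - P B y) \<le> C * norm y"
    using bound[OF B, of "{}"] by simp
  ultimately show ?thesis
    using norm_triangle_ineq4[of "(y - P B y) + P E x" "y - P B y"] by simp
qed

text \<open>
  Cutting \<open>D\<close> into \<open>N\<close> pieces of size at most \<open>s \<le> |B| / \<lambda>\<close> and adding up the bounds on the pieces.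
\<close>

lemma norm_proj_pieces_le:
  fixes l :: real
  assumes bound: "\<And>x L A. \<lbrakk>greedy x L; finite A; l * real (card A) \<le> card L\<rbrakk>
       \<Longrightarrow> norm (x - P L x) \<le> C * norm (x - P A x)"
    and B: "greedy y B" and s: "l * real s \<le> card B" "l \<ge> 1"
    and "finite D" "D \<inter> B = {}" "card D \<le> N * s"
    and "\<And>n. n \<in> D \<Longrightarrow> f n y = 0"
    and "\<And>n b. n \<in> D \<Longrightarrow> b \<in> B \<Longrightarrow> norm (f n x) \<le> norm (f b y)"
  shows "norm (P D x) \<le> N * (2 * C * norm y)"
  using assms(5-9)
proof (induction N arbitrary: D)
  case 0
  then show ?case by simp
next
  case (Suc N)
  have "\<exists>E\<subseteq>D. card E = min s (card D)"
    by (rule obtain_subset_with_card_n[of "min s (card D)" D]) auto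
  then obtain E where E: "E \<subseteq> D" "card E = min s (card D)" by blast
  have finE: "finite E" using E Suc.prems finite_subset by blast
  have "card (D - E) \<le> N * s"
    using E finE Suc.prems(3) by (simp add: card_Diff_subset)
  then have rest: "norm (P (D - E) x) \<le> N * (2 * C * norm y)"
    using Suc.prems by (intro Suc.IH) auto
  have "l * real (card E) \<le> l * real s" using s(2) E by (intro mult_left_mono) auto
  then have "l * real (card E) \<le> card B" using s(1) by linarith
  then have piece: "norm (P E x) \<le> 2 * C * norm y"
    using Suc.prems E(1) finE by (intro norm_proj_small_piece_le[OF bound B, where x = x]) auto
  have "P D x = P E x + P (D - E) x"
    using proj_Un[of E "D - E" x] finE Suc.prems(1) E(1) by (simp add: Un_absorb1)
  then show ?case
    using norm_triangle_ineq[of "P E x" "P (D - E) x"] rest piece by (simp add: algebra_simps)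
qed

text \<open>
  If \<open>|B| \<ge> \<lambda>\<close>, pieces of size \<open>\<lfloor>|B| / \<lambda>\<rfloor> \<ge> |B| / (2\<lambda>)\<close> are available, and \<open>\<lceil>2\<lambda>\<rceil>\<close> of them
  suffice to cover \<open>D\<close>. Otherwise \<open>D\<close> has fewer than \<open>\<lambda>\<close> elements, and each of the coefficients on it
  is bounded by a single coefficient of \<open>y\<close>.
\<close>

lemma norm_proj_dominated_le:
  fixes l :: real
  assumes bound: "\<And>x L A. \<lbrakk>greedy x L; finite A; l * real (card A) \<le> card L\<rbrakk>
       \<Longrightarrow> norm (x - P L x) \<le> C * norm (x - P A x)"
    and C: "C \<ge> 0" and l: "l \<ge> 1"
  obtains C' where "C' \<ge> 0"
    "\<And>x y B D. \<lbrakk>greedy y B; finite D; D \<inter> B = {}; card D \<le> card B;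
        \<And>n. n \<in> D \<Longrightarrow> f n y = 0;
        \<And>n b. n \<in> D \<Longrightarrow> b \<in> B \<Longrightarrow> norm (f n x) \<le> norm (f b y)\<rbrakk>
       \<Longrightarrow> norm (P D x) \<le> C' * norm y"
proof -
  obtain K where K: "K \<ge> 0" "\<And>i j z. norm (f j z) * norm (e i) \<le> K * norm z"
    using coord_bound by blast
  define N where "N = nat \<lceil>2 * l\<rceil>"
  have N: "2 * l \<le> N" unfolding N_def by linarith
  have "norm (P D x) \<le> (N * (2 * C) + l * K) * norm y"
    if B: "greedy y B" and D: "finite D" "D \<inter> B = {}" "card D \<le> card B"
      and supp: "\<And>n. n \<in> D \<Longrightarrow> f n y = 0"
      and dom: "\<And>n b. n \<in> D \<Longrightarrow> b \<in> B \<Longrightarrow> norm (f n x) \<le> norm (f b y)" for x y B D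
  proof (cases "l \<le> card B")
    case True
    define s where "s = nat \<lfloor>card B / l\<rfloor>"
    have "real s \<le> card B / l" unfolding s_def using l by (intro of_nat_floor) simp
    then have s: "l * real s \<le> card B" using l by (simp add: field_simps)
    have "1 \<le> card B / l" using True l by simp
    then have "1 \<le> s" unfolding s_def by linarith
    moreover have "card B / l < real s + 1" unfolding s_def by linarith
    ultimately have "card B / l \<le> 2 * real s" by linarith
    then have "card B \<le> 2 * l * real s" using l by (simp add: field_simps)
    also have "\<dots> \<le> real N * real s" using N by (rule mult_right_mono) simp
    finally have "real (card B) \<le> real (N * s)" by simp
    then have "card D \<le> N * s" using D(3) by linarith
    then have "norm (P D x) \<le> N * (2 * C * norm y)"
      using D supp dom by (intro norm_proj_pieces_le[OF bound B s l]) auto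
    also have "\<dots> \<le> (N * (2 * C) + l * K) * norm y"
      using l K(1) by (simp add: algebra_simps)
    finally show ?thesis .
  next
    case False
    have "norm (P D x) \<le> (\<Sum>n\<in>D. K * norm y)"
    proof (rule order_trans[OF norm_proj_le sum_mono])
      fix n assume n: "n \<in> D"
      then have "card D > 0" using D(1) by (auto simp: card_gt_0_iff)
      then have "card B > 0" using D(3) by linarith
      then obtain b where b: "b \<in> B" by (metis card_gt_0_iff ex_in_conv)
      have "norm (f n x) * norm (e n) \<le> norm (f b y) * norm (e n)"
        by (rule mult_right_mono[OF dom[OF n b]]) simp
      also have "\<dots> \<le> K * norm y" by (rule K(2))
      finally show "norm (f n x) * norm (e n) \<le> K * norm y" .
    qed
    also have "\<dots> = card D * (K * norm y)" by simp
    also have "\<dots> \<le> l * (K * norm y)"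
      using False D(3) K(1) by (intro mult_right_mono) auto
    also have "\<dots> \<le> (N * (2 * C) + l * K) * norm y"
      using C by (simp add: algebra_simps)
    finally show ?thesis .
  qed
  moreover have "0 \<le> N * (2 * C) + l * K" using C l K(1) by simp
  ultimately show thesis using that by blast
qed

text \<open>
  With \<open>B = L - A\<close>, \<open>D = A - L\<close> and \<open>y = x - P\<^sub>A x\<close>, the error splits as
  \<open>x - P\<^sub>L x = (y - P\<^sub>B y) + P\<^sub>D x\<close>: the first summand is bounded because the basis is quasi-greedy,
  the second because every coefficient of \<open>x\<close> on \<open>D\<close> is dominated by every one of \<open>y\<close> on \<open>B\<close>.
\<close>

lemma lambda_imp_almost_greedy:
  assumes "lambda_almost_greedy l scal e" and l: "l \<ge> 1"
  shows "almost_greedy scal e"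
proof -
  obtain C where C: "C \<ge> 0"
    and bound: "\<And>x L A. \<lbrakk>greedy x L; finite A; l * real (card A) \<le> card L\<rbrakk>
       \<Longrightarrow> norm (x - P L x) \<le> C * norm (x - P A x)"
    using lambda_greedy_bound[OF assms] by blast
  obtain C' where C': "C' \<ge> 0"
    and dominated: "\<And>x y B D. \<lbrakk>greedy y B; finite D; D \<inter> B = {}; card D \<le> card B;
        \<And>n. n \<in> D \<Longrightarrow> f n y = 0;
        \<And>n b. n \<in> D \<Longrightarrow> b \<in> B \<Longrightarrow> norm (f n x) \<le> norm (f b y)\<rbrakk>
       \<Longrightarrow> norm (P D x) \<le> C' * norm y"
    using norm_proj_dominated_le[OF bound C l] by blast
  define M where "M = C + C' + 1"
  have M: "M \<ge> 1" using C C' by (simp add: M_def)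
  have key: "norm (x - P L x) \<le> M * norm (x - P A x)"
    if L: "greedy x L" and A: "finite A" "card A = card L" for x L A
  proof -
    have finL: "finite L" using L greedy_finite by blast
    define y B D where "y = x - P A x" and "B = L - A" and "D = A - L"
    have fin: "finite B" "finite D" using finL A by (auto simp: B_def D_def)
    have fy: "f n y = (if n \<in> A then 0 else f n x)" for n
      using A by (simp add: y_def coord_diff coord_proj)
    \<comment> \<open>\<open>y\<close> has the coordinates of \<open>x\<close> outside \<open>A\<close> and vanishing ones on \<open>A\<close>, so \<open>B\<close> inherits
        greediness from \<open>L\<close>.\<close>
    have B: "greedy y B"
      unfolding greedy_set_def fy using fin greedyD[OF L] by (auto simp: B_def)
    have "card A = card (A \<inter> L) + card D" "card L = card (A \<inter> L) + card B"
      using A finL by (auto simp: B_def D_def card_Diff_subset_Int Int_commute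
          intro!: le_add_diff_inverse[symmetric] card_mono)
    then have "card D \<le> card B" using A by simp
    then have pD: "norm (P D x) \<le> C' * norm y"
      using B fin greedyD[OF L]
      by (intro dominated[where B = B]) (auto simp: fy, auto simp: B_def D_def)
    have "norm (y - P B y) \<le> C * norm y" using bound[OF B, of "{}"] by simp
    moreover have "x - P L x = (y - P B y) + P D x"
    proof -
      have "B \<inter> A = {}" by (auto simp: B_def)
      then have "P B (P A x) = 0" using A fin by (simp add: proj_proj)
      then have "P B y = P B x" by (simp add: y_def proj_diff)
      moreover have "A \<inter> L \<union> B = L" "A \<inter> L \<inter> B = {}" "A \<inter> L \<union> D = A" "A \<inter> L \<inter> D = {}"
        by (auto simp: B_def D_def)
      then have "P L x = P (A \<inter> L) x + P B x" "P A x = P (A \<inter> L) x + P D x"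
        using proj_Un[of "A \<inter> L" B x] proj_Un[of "A \<inter> L" D x] finL fin by auto
      ultimately show ?thesis by (simp add: y_def)
    qed
    ultimately have "norm (x - P L x) \<le> C * norm y + C' * norm y"
      using pD norm_triangle_ineq[of "y - P B y" "P D x"] by simp
    also have "\<dots> \<le> M * norm y" by (simp add: M_def algebra_simps)
    finally show ?thesis by (simp add: y_def)
  qed
  have "greedy_error scal e m x \<le> M * proj_error scal e m x" for x m
  proof (rule greedy_error_le)
    fix L assume L: "greedy x L" "card L = m"
    have "norm (x - P L x) / M \<le> proj_error scal e m x"
    proof (rule le_proj_error)
      fix A :: "nat set" assume "finite A" "card A = m"
      then show "norm (x - P L x) / M \<le> norm (x - P A x)"
        using key[of x L A] L M by (simp add: field_simps)
    qed
    then show "norm (x - P L x) \<le> M * proj_error scal e m x"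
      using M by (simp add: field_simps)
  qed
  with M show ?thesis unfolding almost_greedy_def by blast
qed

lemma almost_greedy_iff_lambda:
  "(almost_greedy scal e \<longleftrightarrow> (\<forall>l\<ge>1. lambda_almost_greedy l scal e)) \<and>
   (almost_greedy scal e \<longleftrightarrow> (\<exists>l\<ge>1. lambda_almost_greedy l scal e))"
  using almost_greedy_imp_lambda lambda_imp_almost_greedy by (meson order_refl)

end

theorem theorem1p4:
  fixes e :: "nat \<Rightarrow> 'a::banach"
    and scaleC :: "complex \<Rightarrow> 'b::banach \<Rightarrow> 'b" and d :: "nat \<Rightarrow> 'b"
  shows "(infinite_dimensional ((*\<^sub>R) :: real \<Rightarrow> 'a \<Rightarrow> 'a) \<and> is_basis (*\<^sub>R) e \<longrightarrow>
            (almost_greedy (*\<^sub>R) e \<longleftrightarrow> (\<forall>l\<ge>1. lambda_almost_greedy l (*\<^sub>R) e)) \<and>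
            (almost_greedy (*\<^sub>R) e \<longleftrightarrow> (\<exists>l\<ge>1. lambda_almost_greedy l (*\<^sub>R) e))) \<and>
         (banach_over scaleC \<and> infinite_dimensional scaleC \<and> is_basis scaleC d \<longrightarrow>
            (almost_greedy scaleC d \<longleftrightarrow> (\<forall>l\<ge>1. lambda_almost_greedy l scaleC d)) \<and>
            (almost_greedy scaleC d \<longleftrightarrow> (\<exists>l\<ge>1. lambda_almost_greedy l scaleC d)))"
proof (intro conjI[of "_ \<longrightarrow> _"] impI)
  assume "infinite_dimensional ((*\<^sub>R) :: real \<Rightarrow> 'a \<Rightarrow> 'a) \<and> is_basis (*\<^sub>R) e"
  then have "banach_basis (*\<^sub>R) e"
    by (simp add: banach_basis_def banach_basis_axioms_def banach_over_scaleR)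
  then show "(almost_greedy (*\<^sub>R) e \<longleftrightarrow> (\<forall>l\<ge>1. lambda_almost_greedy l (*\<^sub>R) e)) \<and>
      (almost_greedy (*\<^sub>R) e \<longleftrightarrow> (\<exists>l\<ge>1. lambda_almost_greedy l (*\<^sub>R) e))"
    by (rule banach_basis.almost_greedy_iff_lambda)
next
  assume "banach_over scaleC \<and> infinite_dimensional scaleC \<and> is_basis scaleC d"
  then have "banach_basis scaleC d"
    by (simp add: banach_basis_def banach_basis_axioms_def)
  then show "(almost_greedy scaleC d \<longleftrightarrow> (\<forall>l\<ge>1. lambda_almost_greedy l scaleC d)) \<and>
      (almost_greedy scaleC d \<longleftrightarrow> (\<exists>l\<ge>1. lambda_almost_greedy l scaleC d))"
    by (rule banach_basis.almost_greedy_iff_lambda)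
qed

end
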